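(* Let $A$ be a closed Hermitian operator in a Hilbert space $H$. For $\epsilon>0$ let $$F(A,\epsilon)=\{x : x\in D(A^n),\ \|A^nx\|\le\epsilon^n\|x\|\ \text{ for all } n\in\mathbb{N}\}.$$ Then the following statements are equivalent: (i) $\bigcup_{\epsilon>0}F(A,\epsilon)$ is dense in $H$; (ii) $A$ is self-adjoint.
   Context: Hilbert spaces may be real or complex; $\mathbb{N}=\{1,2,\dots\}$. A linear operator $A$ with domain $D(A)\subset H$ is Hermitian if $\langle Ax,y\rangle=\langle x,Ay\rangle$ for all $x,y\in D(A)$; it is not assumed to be densely defined. Self-adjoint means densely defined with $A=A^*$. *)

theory Defs
  imports "HOL-Analysis.Analysis"
begin

text \<open>Real Hilbert spaces are the types of sort \<open>{real_inner, complete_space}\<close>. The class below is the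
  complex analogue of \<open>real_inner\<close>; the inner product is linear in its first argument, and the last
  axiom contains both positive definiteness and the fact that the norm is induced by it.\<close>

class complex_inner = real_normed_vector +
  fixes scaleC :: "complex \<Rightarrow> 'a \<Rightarrow> 'a"
    and cinner :: "'a \<Rightarrow> 'a \<Rightarrow> complex"
  assumes scaleC_add_right: "scaleC c (x + y) = scaleC c x + scaleC c y"
    and scaleC_add_left: "scaleC (c + d) x = scaleC c x + scaleC d x"
    and scaleC_scaleC: "scaleC c (scaleC d x) = scaleC (c * d) x"
    and scaleC_of_real: "scaleC (complex_of_real r) x = r *\<^sub>R x"
    and cinner_commute: "cinner x y = cnj (cinner y x)"
    and cinner_add_left: "cinner (x + y) z = cinner x z + cinner y z"
    and cinner_scaleC_left: "cinner (scaleC c x) y = c * cinner x y"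
    and cinner_self: "cinner x x = complex_of_real ((norm x)\<^sup>2)"

class complex_hilbert_space = complex_inner + complete_space

instantiation complex :: complex_hilbert_space
begin

definition scaleC_complex :: "complex \<Rightarrow> complex \<Rightarrow> complex"
  where "scaleC_complex c x = c * x"

definition cinner_complex :: "complex \<Rightarrow> complex \<Rightarrow> complex"
  where "cinner_complex x y = x * cnj y"

instance
  by standard
    (simp_all add: scaleC_complex_def cinner_complex_def algebra_simps scaleR_conv_of_real
      complex_norm_square del: of_real_power)

end

lemma vector_space_scaleC: "vector_space (scaleC :: complex \<Rightarrow> 'a::complex_inner \<Rightarrow> 'a)"
proof
  fix x :: 'a
  show "scaleC 1 x = x"
    using scaleC_of_real[of 1 x] by simp
qed (simp_all add: scaleC_add_right scaleC_add_left scaleC_scaleC)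

text \<open>An operator is given by its domain \<open>D\<close> and a map \<open>A\<close> whose values outside \<open>D\<close> are irrelevant.
  The scalar multiplication and the inner product are parameters, so that the same definitions
  serve the real and the complex case.\<close>

definition linear_operator ::
    "('k::field \<Rightarrow> 'a::ab_group_add \<Rightarrow> 'a) \<Rightarrow> 'a set \<Rightarrow> ('a \<Rightarrow> 'a) \<Rightarrow> bool" where
  "linear_operator smul D A \<longleftrightarrow>
     module.subspace smul D \<and>
     (\<forall>x\<in>D. \<forall>y\<in>D. A (x + y) = A x + A y) \<and>
     (\<forall>c. \<forall>x\<in>D. A (smul c x) = smul c (A x))"

definition operator_graph :: "'a set \<Rightarrow> ('a \<Rightarrow> 'a) \<Rightarrow> ('a \<times> 'a) set" where
  "operator_graph D A = {(x, A x) | x. x \<in> D}"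

definition closed_operator :: "'a::topological_space set \<Rightarrow> ('a \<Rightarrow> 'a) \<Rightarrow> bool" where
  "closed_operator D A \<longleftrightarrow> closed (operator_graph D A)"

definition hermitian_operator :: "('a \<Rightarrow> 'a \<Rightarrow> 'k) \<Rightarrow> 'a set \<Rightarrow> ('a \<Rightarrow> 'a) \<Rightarrow> bool" where
  "hermitian_operator ip D A \<longleftrightarrow> (\<forall>x\<in>D. \<forall>y\<in>D. ip (A x) y = ip x (A y))"

text \<open>This relation is single-valued, hence the graph of an operator, precisely when \<open>D\<close> is dense.\<close>

definition adjoint_graph :: "('a \<Rightarrow> 'a \<Rightarrow> 'k) \<Rightarrow> 'a set \<Rightarrow> ('a \<Rightarrow> 'a) \<Rightarrow> ('a \<times> 'a) set" where
  "adjoint_graph ip D A = {(y, z). \<forall>x\<in>D. ip (A x) y = ip x z}"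

definition self_adjoint_operator ::
    "('a::topological_space \<Rightarrow> 'a \<Rightarrow> 'k) \<Rightarrow> 'a set \<Rightarrow> ('a \<Rightarrow> 'a) \<Rightarrow> bool" where
  "self_adjoint_operator ip D A \<longleftrightarrow>
     closure D = UNIV \<and> operator_graph D A = adjoint_graph ip D A"

primrec power_domain :: "'a set \<Rightarrow> ('a \<Rightarrow> 'a) \<Rightarrow> nat \<Rightarrow> 'a set" where
  "power_domain D A 0 = UNIV"
| "power_domain D A (Suc n) = {x \<in> power_domain D A n. (A ^^ n) x \<in> D}"

definition bounded_vectors :: "'a::real_normed_vector set \<Rightarrow> ('a \<Rightarrow> 'a) \<Rightarrow> real \<Rightarrow> 'a set" where
  "bounded_vectors D A \<epsilon> =
     {x. \<forall>n\<ge>1. x \<in> power_domain D A n \<and> norm ((A ^^ n) x) \<le> \<epsilon> ^ n * norm x}"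

end

theory Submission
  imports Defs
begin

text \<open>For Hermitian \<open>A\<close> the sequence \<open>\<parallel>A\<^sup>n x\<parallel>\<close> is log-convex, so \<open>x \<in> F(A, \<epsilon>)\<close> already follows from
  \<open>\<parallel>A\<^sup>n x\<parallel> \<le> M \<epsilon>\<^sup>n\<close>; hence \<open>F(A, \<epsilon>)\<close> is a closed subspace, invariant under \<open>A\<close>.  If these subspaces
  have a dense union, then projecting a point \<open>(y, z)\<close> of the graph of \<open>A\<^sup>*\<close> to them gives points
  of the graph of \<open>A\<close> converging to \<open>(y, z)\<close>.

  Conversely, for self-adjoint \<open>A\<close> put \<open>T = (1 + A\<^sup>2)\<^sup>-\<^sup>1\<close>.  The orthogonal complement \<open>K\<close> of \<open>F(T, \<delta>)\<close>
  is mapped by \<open>T\<close> bijectively to itself with an inverse bounded by \<open>1 / \<delta>\<close>, so \<open>A\<^sup>2 = T\<^sup>-\<^sup>1 - 1\<close> is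
  bounded on \<open>K\<close> and \<open>K\<close> consists of bounded vectors of \<open>A\<close>.  The union of these complements over
  \<open>\<delta>\<close> is dense since \<open>F(T, \<delta>)\<close> shrinks to \<open>ker T = 0\<close>.

  A complex Hilbert space is treated as a real one with inner product \<open>Re \<langle>x, y\<rangle>\<close>; the adjoint does
  not change, because the domain is closed under multiplication by \<open>\<i>\<close>.\<close>

section \<open>Log-convex sequences\<close>

text \<open>Log-convexity makes the ratios of successive terms nondecreasing. One ratio r above
  \<open>\<epsilon>\<close> would therefore persist and force growth like r^j, which
  \<open>M * \<epsilon> ^ n\<close> excludes. So every ratio is at most \<open>\<epsilon>\<close>,
  and the constant M can be replaced by \<open>a 0\<close>.\<close>

lemma log_convex_growth:
  fixes a :: "nat \<Rightarrow> real"
  assumes nonneg: "\<And>n. 0 \<le> a n"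
    and convex: "\<And>n. (a (Suc n))\<^sup>2 \<le> a n * a (Suc (Suc n))"
    and bound: "\<And>n. a n \<le> M * \<epsilon> ^ n" and "0 < \<epsilon>"
  shows "a n \<le> \<epsilon> ^ n * a 0"
proof -
  have step: "a (Suc k) \<le> \<epsilon> * a k" for k
  proof (rule ccontr)
    assume less: "\<not> a (Suc k) \<le> \<epsilon> * a k"
    have "0 < a (Suc k)"
      using less mult_nonneg_nonneg[of \<epsilon> "a k"] nonneg[of k] \<open>0 < \<epsilon>\<close> by linarith
    then have "a k \<noteq> 0"
      using convex[of k] by auto
    then have "0 < a k"
      using nonneg[of k] by linarith
    define r where "r = a (Suc k) / a k"
    have "\<epsilon> < r"
      using less \<open>0 < a k\<close> by (simp add: r_def field_simps)
    \<comment> \<open>Positivity is carried along with the ratio bound because the induction step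
      cancels the factor \<open>a (k + j)\<close>.\<close>
    have growth: "0 < a (k + j) \<and> r * a (k + j) \<le> a (Suc (k + j))" for j
    proof (induction j)
      case 0
      show ?case using \<open>0 < a k\<close> by (simp add: r_def)
    next
      case (Suc j)
      let ?m = "k + j"
      have pos: "0 < a (Suc ?m)"
        using Suc \<open>\<epsilon> < r\<close> \<open>0 < \<epsilon>\<close> by (metis less_le_trans less_trans mult_pos_pos)
      have "a ?m * (r * a (Suc ?m)) \<le> a (Suc ?m) * a (Suc ?m)"
        using Suc pos mult_right_mono[of "r * a ?m" "a (Suc ?m)" "a (Suc ?m)"]
        by (simp add: mult_ac)
      also have "\<dots> \<le> a ?m * a (Suc (Suc ?m))"
        using convex[of ?m] by (simp add: power2_eq_square)
      finally show ?case
        using Suc pos by (simp add: mult_le_cancel_left)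
    qed
    have lower: "r ^ j * a k \<le> a (k + j)" for j
    proof (induction j)
      case (Suc j)
      have "r * (r ^ j * a k) \<le> r * a (k + j)"
        using Suc \<open>\<epsilon> < r\<close> \<open>0 < \<epsilon>\<close> by (intro mult_left_mono) auto
      then show ?case
        using growth[of j] by (simp add: mult_ac)
    qed simp
    have "(r / \<epsilon>) ^ j \<le> M * \<epsilon> ^ k / a k" for j
    proof -
      have "r ^ j * a k \<le> M * \<epsilon> ^ k * \<epsilon> ^ j"
        using lower[of j] bound[of "k + j"] by (simp add: power_add mult_ac)
      then show ?thesis
        using \<open>0 < a k\<close> \<open>0 < \<epsilon>\<close> by (simp add: field_simps)
    qed
    moreover have "1 < r / \<epsilon>"
      using \<open>\<epsilon> < r\<close> \<open>0 < \<epsilon>\<close> by simp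
    then obtain j where "M * \<epsilon> ^ k / a k < (r / \<epsilon>) ^ j"
      using real_arch_pow by blast
    ultimately show False
      by (meson not_less)
  qed
  show ?thesis
  proof (induction n)
    case (Suc n)
    have "\<epsilon> * a n \<le> \<epsilon> * (\<epsilon> ^ n * a 0)"
      using Suc \<open>0 < \<epsilon>\<close> by simp
    then show ?case
      using step[of n] by (simp add: mult_ac)
  qed simp
qed

section \<open>Subspaces, operators and their powers\<close>

lemma subspace_closure:
  fixes M :: "'a::real_normed_vector set"
  assumes "subspace M"
  shows "subspace (closure M)"
proof (rule subspaceI)
  show "0 \<in> closure M"
    using subspace_0[OF assms] closure_subset by blast
next
  fix x y assume "x \<in> closure M" "y \<in> closure M"
  then obtain X Y where "\<And>n. X n \<in> M" "X \<longlonglongrightarrow> x" "\<And>n. Y n \<in> M" "Y \<longlonglongrightarrow> y"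
    by (metis closure_sequential)
  then show "x + y \<in> closure M"
    unfolding closure_sequential
    by (intro exI[of _ "\<lambda>n. X n + Y n"]) (auto intro: tendsto_add subspace_add[OF assms])
next
  fix c x assume "x \<in> closure M"
  then obtain X where "\<And>n. X n \<in> M" "X \<longlonglongrightarrow> x"
    by (metis closure_sequential)
  then show "c *\<^sub>R x \<in> closure M"
    unfolding closure_sequential
    by (intro exI[of _ "\<lambda>n. c *\<^sub>R X n"]) (auto intro: tendsto_scaleR subspace_scale[OF assms])
qed

lemma linear_operatorD:
  assumes "linear_operator (scaleR :: real \<Rightarrow> 'a \<Rightarrow> 'a::real_normed_vector) D A"
  shows linear_operator_subspace: "subspace D"
    and linear_operator_add: "\<And>x y. x \<in> D \<Longrightarrow> y \<in> D \<Longrightarrow> A (x + y) = A x + A y"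
    and linear_operator_scale: "\<And>c x. x \<in> D \<Longrightarrow> A (c *\<^sub>R x) = c *\<^sub>R A x"
  using assms by (auto simp: linear_operator_def subspace_raw_def)

lemma linear_operator_zero:
  assumes "linear_operator (scaleR :: real \<Rightarrow> 'a \<Rightarrow> 'a::real_normed_vector) D A"
  shows "A 0 = 0"
  using linear_operator_scale[OF assms subspace_0[OF linear_operator_subspace[OF assms]], of 0]
  by simp

lemma linear_operator_diff:
  assumes "linear_operator (scaleR :: real \<Rightarrow> 'a \<Rightarrow> 'a::real_normed_vector) D A"
    and "x \<in> D" "y \<in> D"
  shows "A (x - y) = A x - A y"
proof -
  have "- y \<in> D"
    using assms subspace_neg linear_operator_subspace by blast
  then have "A (x + - y) = A x + A (- y)"
    using assms linear_operator_add by blast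
  moreover have "A (- y) = - A y"
    using linear_operator_scale[OF assms(1,3), of "-1"] by simp
  ultimately show ?thesis by simp
qed

text \<open>The definition splits off the last application of A. Splitting off the first one instead
  suits inductions that pass from x to \<open>A x\<close>, so it replaces the defining equation as
  the standard unfolding.\<close>

lemma power_domain_Suc_iff:
  "x \<in> power_domain D A (Suc n) \<longleftrightarrow> x \<in> D \<and> A x \<in> power_domain D A n"
  by (induction n) (auto simp: funpow_swap1)

declare power_domain.simps(2) [simp del]

text \<open>The definition speaks of \<open>n \<ge> 1\<close> only; including the trivial case
  \<open>n = 0\<close> lets later inductions start there.\<close>

lemma bounded_vectorsD:
  assumes "x \<in> bounded_vectors D A \<epsilon>"
  shows "x \<in> power_domain D A n" "norm ((A ^^ n) x) \<le> \<epsilon> ^ n * norm x"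
  using assms by (cases n; auto simp: bounded_vectors_def)+

lemma bounded_vectorsI:
  assumes "\<And>n. x \<in> power_domain D A n" "\<And>n. norm ((A ^^ n) x) \<le> \<epsilon> ^ n * norm x"
  shows "x \<in> bounded_vectors D A \<epsilon>"
  using assms by (auto simp: bounded_vectors_def)

lemma bounded_vectors_subset: "bounded_vectors D A \<epsilon> \<subseteq> D"
  using bounded_vectorsD(1)[of _ D A \<epsilon> 1] by (auto simp: power_domain_Suc_iff)

lemma bounded_vectors_norm_le:
  "x \<in> bounded_vectors D A \<epsilon> \<Longrightarrow> norm (A x) \<le> \<epsilon> * norm x"
  using bounded_vectorsD(2)[of x D A \<epsilon> 1] by simp

lemma bounded_vectors_mono:
  assumes "0 \<le> \<delta>" "\<delta> \<le> \<epsilon>"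
  shows "bounded_vectors D A \<delta> \<subseteq> bounded_vectors D A \<epsilon>"
proof
  fix x assume x: "x \<in> bounded_vectors D A \<delta>"
  show "x \<in> bounded_vectors D A \<epsilon>"
  proof (rule bounded_vectorsI)
    fix n
    have "\<delta> ^ n * norm x \<le> \<epsilon> ^ n * norm x"
      using assms by (intro mult_right_mono power_mono) auto
    then show "norm ((A ^^ n) x) \<le> \<epsilon> ^ n * norm x"
      using bounded_vectorsD(2)[OF x, of n] by linarith
  qed (rule bounded_vectorsD(1)[OF x])
qed

lemma power_domain_add:
  assumes "linear_operator (scaleR :: real \<Rightarrow> 'a \<Rightarrow> 'a::real_normed_vector) D A"
    and "x \<in> power_domain D A n" "y \<in> power_domain D A n"
  shows "x + y \<in> power_domain D A n \<and> (A ^^ n) (x + y) = (A ^^ n) x + (A ^^ n) y"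
  using assms(2-)
proof (induction n arbitrary: x y)
  case (Suc n)
  then show ?case
    using subspace_add[OF linear_operator_subspace[OF assms(1)], of x y]
      linear_operator_add[OF assms(1), of x y]
    by (auto simp: power_domain_Suc_iff funpow_Suc_right simp del: funpow.simps)
qed simp

lemma power_domain_scale:
  assumes "linear_operator (scaleR :: real \<Rightarrow> 'a \<Rightarrow> 'a::real_normed_vector) D A"
    and "x \<in> power_domain D A n"
  shows "c *\<^sub>R x \<in> power_domain D A n \<and> (A ^^ n) (c *\<^sub>R x) = c *\<^sub>R (A ^^ n) x"
  using assms(2-)
proof (induction n arbitrary: x)
  case (Suc n)
  then show ?case
    using subspace_scale[OF linear_operator_subspace[OF assms(1)], of x c]
      linear_operator_scale[OF assms(1), of x c]
    by (auto simp: power_domain_Suc_iff funpow_Suc_right simp del: funpow.simps)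
qed simp

lemma closed_operator_limit:
  assumes "closed_operator D A" "\<And>n. X n \<in> D" "X \<longlonglongrightarrow> x" "(\<lambda>n. A (X n)) \<longlonglongrightarrow> y"
  shows "x \<in> D \<and> A x = y"
proof -
  have "(x, y) \<in> operator_graph D A"
    using assms(1) unfolding closed_operator_def
    by (rule closed_sequentially[where f = "\<lambda>n. (X n, A (X n))"])
      (use assms in \<open>auto simp: operator_graph_def intro: tendsto_Pair\<close>)
  then show ?thesis
    by (auto simp: operator_graph_def)
qed

text \<open>Used for images under A of a convergent sequence of bounded vectors, and for the square
  root iterates compared with their scalar majorants. The two sequences may thus live in different
  spaces.\<close>

lemma Cauchy_of_norm_le:
  fixes X :: "nat \<Rightarrow> 'a::real_normed_vector" and Y :: "nat \<Rightarrow> 'b::real_normed_vector"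
  assumes le: "\<And>i j. norm (Y i - Y j) \<le> c * norm (X i - X j)" and "Cauchy X"
  shows "Cauchy Y"
proof (rule CauchyI)
  fix e :: real assume "0 < e"
  define d where "d = e / (\<bar>c\<bar> + 1)"
  have "0 < d"
    using \<open>0 < e\<close> by (simp add: d_def)
  then obtain N where N: "\<And>i j. N \<le> i \<Longrightarrow> N \<le> j \<Longrightarrow> norm (X i - X j) < d"
    using CauchyD[OF \<open>Cauchy X\<close>] by meson
  have "norm (Y i - Y j) < e" if "N \<le> i" "N \<le> j" for i j
  proof -
    have "c * norm (X i - X j) \<le> (\<bar>c\<bar> + 1) * norm (X i - X j)"
      by (intro mult_right_mono) auto
    also have "\<dots> < (\<bar>c\<bar> + 1) * d"
      using N[OF that] by (intro mult_strict_left_mono) auto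
    also have "\<dots> = e"
      by (simp add: d_def)
    finally show ?thesis
      using le[of i j] by linarith
  qed
  then show "\<exists>N. \<forall>i\<ge>N. \<forall>j\<ge>N. norm (Y i - Y j) < e"
    by blast
qed

section \<open>Inner forms and orthogonal projection\<close>

text \<open>The form is a parameter rather than the class operation, so that the real inner product,
  the real part of a complex one, and the sum form on the product space are all instances.\<close>

locale real_inner_form =
  fixes ip :: "'a::{real_normed_vector, complete_space} \<Rightarrow> 'a \<Rightarrow> real"
  assumes commute: "ip x y = ip y x"
    and form_add_left: "ip (x + y) z = ip x z + ip y z"
    and form_scale_left: "ip (c *\<^sub>R x) y = c * ip x y"
    and form_self: "ip x x = (norm x)\<^sup>2"
begin

lemma form_add_right: "ip z (x + y) = ip z x + ip z y"
  by (metis commute form_add_left)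

lemma form_scale_right: "ip x (c *\<^sub>R y) = c * ip x y"
  by (metis commute form_scale_left)

text \<open>The triangle inequality for the given norm is already available; squaring and expanding
  it yields the claim.\<close>

lemma Cauchy_Schwarz: "ip x y \<le> norm x * norm y"
proof -
  have "(norm (x + y))\<^sup>2 \<le> (norm x + norm y)\<^sup>2"
    by (intro power_mono norm_triangle_ineq norm_ge_zero)
  then show ?thesis
    by (simp add: form_self[symmetric] form_add_left form_add_right commute[of y x] power2_sum)
qed

sublocale ip: bounded_bilinear ip
proof
  have "\<bar>ip x y\<bar> \<le> norm x * norm y * 1" for x y
    using Cauchy_Schwarz[of x y] Cauchy_Schwarz[of "-1 *\<^sub>R x" y]
    by (simp only: form_scale_left) auto
  then show "\<exists>K. \<forall>x y. norm (ip x y) \<le> norm x * norm y * K"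
    by (metis real_norm_def)
qed (simp_all add: form_add_left form_add_right form_scale_left form_scale_right)

lemma norm_add_sq: "(norm (x + y))\<^sup>2 = (norm x)\<^sup>2 + 2 * ip x y + (norm y)\<^sup>2"
  by (simp add: form_self[symmetric] form_add_left form_add_right commute[of y x])

lemma norm_diff_sq: "(norm (x - y))\<^sup>2 = (norm x)\<^sup>2 - 2 * ip x y + (norm y)\<^sup>2"
  by (simp add: form_self[symmetric] ip.diff_left ip.diff_right commute[of y x])

text \<open>A minimizing sequence for the distance from x to M is Cauchy by the parallelogram law,
  and its limit is the nearest point. The minimality is exported too, since it turns approximation
  by any element of M into approximation by p.\<close>

lemma orthogonal_projection:
  assumes M: "subspace M" "closed M"
  obtains p where "p \<in> M" "\<And>m. m \<in> M \<Longrightarrow> ip (x - p) m = 0"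
    "\<And>m. m \<in> M \<Longrightarrow> norm (x - p) \<le> norm (x - m)"
proof -
  define S where "S = (\<lambda>m. (norm (x - m))\<^sup>2) ` M"
  define d where "d = Inf S"
  have "S \<noteq> {}"
    using subspace_0[OF M(1)] by (auto simp: S_def)
  have "bdd_below S"
    by (auto simp: S_def intro!: bdd_belowI[of _ 0])
  then have le: "d \<le> (norm (x - m))\<^sup>2" if "m \<in> M" for m
    using that by (auto simp: d_def S_def intro: cInf_lower)
  have "\<exists>m\<in>M. (norm (x - m))\<^sup>2 < d + inverse (Suc n)" for n
    using cInf_lessD[OF \<open>S \<noteq> {}\<close>, of "d + inverse (Suc n)"] by (auto simp: d_def S_def)
  then obtain m where m: "\<And>n. m n \<in> M" "\<And>n. (norm (x - m n))\<^sup>2 < d + inverse (Suc n)"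
    by metis
  \<comment> \<open>The midpoint of \<open>m i\<close> and \<open>m j\<close> lies in M, so
    \<open>4 * d\<close> is at most the squared norm of u + v; the parallelogram law then bounds
    that of u - v.\<close>
  have dist: "(norm (m i - m j))\<^sup>2 \<le> 2 * inverse (Suc i) + 2 * inverse (Suc j)" for i j
  proof -
    define u v where "u = x - m i" and "v = x - m j"
    have "(1/2) *\<^sub>R (m i + m j) \<in> M"
      using m(1) M(1) by (intro subspace_scale subspace_add)
    then have "d \<le> (norm (x - (1/2) *\<^sub>R (m i + m j)))\<^sup>2"
      by (rule le)
    also have "x - (1/2) *\<^sub>R (m i + m j) = (1/2) *\<^sub>R (u + v)"
      by (simp add: u_def v_def algebra_simps flip: scaleR_add_left)
    also have "(norm ((1/2) *\<^sub>R (u + v)))\<^sup>2 = (norm (u + v))\<^sup>2 / 4"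
      by (simp add: power_divide)
    finally have "4 * d \<le> (norm (u + v))\<^sup>2"
      by simp
    moreover have "(norm (m i - m j))\<^sup>2 = (norm (u - v))\<^sup>2"
      by (simp add: u_def v_def norm_minus_commute)
    ultimately show ?thesis
      using m(2)[of i, folded u_def] m(2)[of j, folded v_def]
      unfolding norm_add_sq norm_diff_sq[of u v] by linarith
  qed
  have "Cauchy m"
  proof (rule CauchyI)
    fix e :: real assume "0 < e"
    then obtain N where N: "inverse (Suc N) < e\<^sup>2 / 4"
      using reals_Archimedean[of "e\<^sup>2 / 4"] by auto
    have "norm (m i - m j) < e" if "N \<le> i" "N \<le> j" for i j
    proof -
      have "inverse (Suc i) \<le> inverse (real (Suc N))" "inverse (Suc j) \<le> inverse (real (Suc N))"
        using that by (auto simp: le_imp_inverse_le)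
      then have "(norm (m i - m j))\<^sup>2 < e\<^sup>2"
        using dist[of i j] N by linarith
      then show ?thesis
        using \<open>0 < e\<close> power_less_imp_less_base by fastforce
    qed
    then show "\<exists>N. \<forall>i\<ge>N. \<forall>j\<ge>N. norm (m i - m j) < e"
      by blast
  qed
  then obtain p where p: "m \<longlonglongrightarrow> p"
    using Cauchy_convergent convergent_def by blast
  then have "p \<in> M"
    using M(2) m(1) closed_sequentially by blast
  have "(\<lambda>n. (norm (x - m n))\<^sup>2) \<longlonglongrightarrow> (norm (x - p))\<^sup>2"
    by (intro tendsto_intros p)
  moreover have "(\<lambda>n. d + inverse (Suc n)) \<longlonglongrightarrow> d + 0"
    by (intro tendsto_add tendsto_const LIMSEQ_inverse_real_of_nat)
  ultimately have "(norm (x - p))\<^sup>2 \<le> d"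
    using m(2) by (intro LIMSEQ_le[where Y = "\<lambda>n. d + inverse (Suc n)"]) (auto intro: less_imp_le)
  then have min: "(norm (x - p))\<^sup>2 \<le> (norm (x - y))\<^sup>2" if "y \<in> M" for y
    using le[OF that] by linarith
  have "ip (x - p) y = 0" if "y \<in> M" for y
  proof (cases "y = 0")
    case False
    \<comment> \<open>This t minimizes the distance from x to p + t y, so that minimality of p
      forces the gain, the square of \<open>ip (x - p) y\<close> over that of \<open>norm y\<close>,
      to vanish.\<close>
    define t where "t = ip (x - p) y / (norm y)\<^sup>2"
    have "(norm (x - p))\<^sup>2 \<le> (norm (x - (p + t *\<^sub>R y)))\<^sup>2"
      using \<open>p \<in> M\<close> that M(1) by (intro min subspace_add subspace_scale)
    also have "\<dots> = (norm (x - p - t *\<^sub>R y))\<^sup>2"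
      by (simp add: diff_diff_eq)
    also have "\<dots> = (norm (x - p))\<^sup>2 - 2 * (t * ip (x - p) y) + t\<^sup>2 * (norm y)\<^sup>2"
      by (simp add: norm_diff_sq[of "x - p"] form_scale_right power_mult_distrib)
    finally have "2 * (t * ip (x - p) y) \<le> t\<^sup>2 * (norm y)\<^sup>2"
      by simp
    moreover have "t\<^sup>2 * (norm y)\<^sup>2 = t * ip (x - p) y"
      using False by (simp add: t_def power2_eq_square)
    moreover have "t * ip (x - p) y = (ip (x - p) y)\<^sup>2 / (norm y)\<^sup>2"
      by (simp add: t_def power2_eq_square)
    ultimately have "(ip (x - p) y)\<^sup>2 / (norm y)\<^sup>2 \<le> 0"
      by linarith
    then show ?thesis
      using False by (simp add: divide_le_0_iff)
  qed (simp add: ip.zero_right)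
  with that \<open>p \<in> M\<close> min show thesis
    by (meson norm_ge_zero power2_le_imp_le)
qed

lemma dense_subspaceI:
  assumes "subspace M" and perp: "\<And>z. (\<And>m. m \<in> M \<Longrightarrow> ip z m = 0) \<Longrightarrow> z = 0"
  shows "closure M = UNIV"
proof -
  have "x \<in> closure M" for x
  proof -
    obtain p where p: "p \<in> closure M" "\<And>m. m \<in> closure M \<Longrightarrow> ip (x - p) m = 0"
      using orthogonal_projection[OF subspace_closure[OF assms(1)] closed_closure, of x] by metis
    then have "x - p = 0"
      using perp closure_subset by blast
    with p show ?thesis by simp
  qed
  then show ?thesis by blast
qed

text \<open>If p is the projection of z to M, then z - p is itself orthogonal to M, so it is
  orthogonal to both z and p and hence to itself.\<close>

lemma double_complement:
  assumes "subspace M" "closed M" and perp: "\<And>k. (\<And>m. m \<in> M \<Longrightarrow> ip k m = 0) \<Longrightarrow> ip z k = 0"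
  shows "z \<in> M"
proof -
  obtain p where p: "p \<in> M" "\<And>m. m \<in> M \<Longrightarrow> ip (z - p) m = 0"
    using orthogonal_projection[OF assms(1,2), of z] by metis
  then have "ip (z - p) (z - p) = 0"
    using perp[OF p(2)] p(2)[OF p(1)] commute[of p "z - p"] by (simp add: ip.diff_left)
  then have "z = p"
    by (simp add: form_self)
  with p show ?thesis by simp
qed

section \<open>Bounded vectors of a Hermitian operator\<close>

text \<open>Moving one A across the form writes the squared norm of A^(n+1) x as the product of A^n
  x with A^(n+2) x, so Cauchy-Schwarz gives log-convexity of the norms.\<close>

lemma bounded_vectorsI_of_growth:
  assumes herm: "hermitian_operator ip D A"
    and dom: "\<And>n. x \<in> power_domain D A n"
    and bound: "\<And>n. norm ((A ^^ n) x) \<le> M * \<epsilon> ^ n" and "0 < \<epsilon>"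
  shows "x \<in> bounded_vectors D A \<epsilon>"
proof (rule bounded_vectorsI[OF dom])
  have in_D: "(A ^^ n) x \<in> D" for n
    using dom[of "Suc n"] by (simp add: power_domain.simps)
  have "(norm ((A ^^ Suc n) x))\<^sup>2 \<le> norm ((A ^^ n) x) * norm ((A ^^ Suc (Suc n)) x)" for n
    using Cauchy_Schwarz[of "(A ^^ n) x" "(A ^^ Suc (Suc n)) x"] herm in_D[of n] in_D[of "Suc n"]
    by (simp add: form_self[symmetric] hermitian_operator_def)
  then show "norm ((A ^^ n) x) \<le> \<epsilon> ^ n * norm x" for n
    using log_convex_growth[of "\<lambda>n. norm ((A ^^ n) x)" M \<epsilon> n] bound \<open>0 < \<epsilon>\<close> by simp
qed

text \<open>The direct estimate has the constant \<open>\<epsilon> * norm x\<close> where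
  \<open>norm (A x)\<close> is required; the growth criterion accepts any constant.\<close>

lemma bounded_vectors_invariant:
  assumes "hermitian_operator ip D A" and x: "x \<in> bounded_vectors D A \<epsilon>" and "0 < \<epsilon>"
  shows "A x \<in> bounded_vectors D A \<epsilon>"
proof (rule bounded_vectorsI_of_growth[OF assms(1)])
  show "A x \<in> power_domain D A n" for n
    using bounded_vectorsD(1)[OF x, of "Suc n"] by (simp add: power_domain_Suc_iff)
  show "norm ((A ^^ n) (A x)) \<le> (\<epsilon> * norm x) * \<epsilon> ^ n" for n
    using bounded_vectorsD(2)[OF x, of "Suc n"] by (simp add: funpow_swap1 mult_ac)
qed fact

text \<open>For sums the triangle inequality only yields the constant
  \<open>norm x + norm y\<close>, which again suffices by the growth criterion.\<close>

lemma subspace_bounded_vectors: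
  assumes lin: "linear_operator scaleR D A" and "hermitian_operator ip D A" and "0 < \<epsilon>"
  shows "subspace (bounded_vectors D A \<epsilon>)"
proof (rule subspaceI)
  have zero: "A 0 = 0" "0 \<in> D"
    using linear_operator_zero[OF lin] linear_operator_subspace[OF lin] subspace_0 by auto
  have "0 \<in> power_domain D A n \<and> (A ^^ n) 0 = 0" for n
    by (induction n) (use zero in \<open>auto simp: power_domain_Suc_iff\<close>)
  then show "0 \<in> bounded_vectors D A \<epsilon>"
    by (intro bounded_vectorsI) auto
next
  fix x y assume x: "x \<in> bounded_vectors D A \<epsilon>" and y: "y \<in> bounded_vectors D A \<epsilon>"
  note * = power_domain_add[OF lin bounded_vectorsD(1)[OF x] bounded_vectorsD(1)[OF y]]
  show "x + y \<in> bounded_vectors D A \<epsilon>"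
  proof (rule bounded_vectorsI_of_growth[OF assms(2)])
    fix n
    have "norm ((A ^^ n) (x + y)) \<le> norm ((A ^^ n) x) + norm ((A ^^ n) y)"
      using * norm_triangle_ineq by simp
    also have "\<dots> \<le> (norm x + norm y) * \<epsilon> ^ n"
      using bounded_vectorsD(2)[OF x, of n] bounded_vectorsD(2)[OF y, of n]
      by (simp add: algebra_simps)
    finally show "norm ((A ^^ n) (x + y)) \<le> (norm x + norm y) * \<epsilon> ^ n" .
  qed (use * \<open>0 < \<epsilon>\<close> in auto)
next
  fix c x assume x: "x \<in> bounded_vectors D A \<epsilon>"
  note * = power_domain_scale[OF lin bounded_vectorsD(1)[OF x]]
  show "c *\<^sub>R x \<in> bounded_vectors D A \<epsilon>"
    using * bounded_vectorsD(2)[OF x]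
    by (intro bounded_vectorsI) (auto simp: mult.left_commute[of _ "\<bar>c\<bar>"] mult_left_mono)
qed

text \<open>On this subspace A is bounded by \<open>\<epsilon>\<close>, so images of a convergent
  sequence converge, and closedness of A identifies their limit. Invariance allows this to be
  repeated for every power of A.\<close>

lemma closed_bounded_vectors:
  assumes lin: "linear_operator scaleR D A" and "hermitian_operator ip D A"
    and "closed_operator D A" and "0 < \<epsilon>"
  shows "closed (bounded_vectors D A \<epsilon>)"
proof -
  let ?F = "bounded_vectors D A \<epsilon>"
  have limit: "\<exists>y. (\<lambda>k. A (X k)) \<longlonglongrightarrow> y \<and> x \<in> D \<and> A x = y" if X: "\<And>k. X k \<in> ?F" "X \<longlonglongrightarrow> x" for X x
  proof -
    have "norm (A (X i) - A (X j)) \<le> \<epsilon> * norm (X i - X j)" for i j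
    proof -
      have "X i - X j \<in> ?F"
        using X(1) subspace_bounded_vectors[OF assms(1,2,4)] by (intro subspace_diff)
      moreover have "A (X i - X j) = A (X i) - A (X j)"
        using linear_operator_diff[OF lin] bounded_vectors_subset X(1) by blast
      ultimately show ?thesis
        using bounded_vectors_norm_le by metis
    qed
    moreover have "Cauchy X"
      using X(2) by (rule LIMSEQ_imp_Cauchy)
    ultimately have "Cauchy (\<lambda>k. A (X k))"
      by (rule Cauchy_of_norm_le)
    then obtain y where y: "(\<lambda>k. A (X k)) \<longlonglongrightarrow> y"
      using Cauchy_convergent convergent_def by blast
    then show ?thesis
      using closed_operator_limit[OF assms(3) _ X(2) y] bounded_vectors_subset X(1) by blast
  qed
  have powers: "x \<in> power_domain D A n \<and> (\<lambda>k. (A ^^ n) (X k)) \<longlonglongrightarrow> (A ^^ n) x"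
    if "\<And>k. X k \<in> ?F" "X \<longlonglongrightarrow> x" for X x n
    using that
  proof (induction n arbitrary: X x)
    case (Suc n)
    have "x \<in> D" "(\<lambda>k. A (X k)) \<longlonglongrightarrow> A x"
      using limit[OF Suc.prems] by auto
    moreover have "A (X k) \<in> ?F" for k
      using bounded_vectors_invariant[OF assms(2) Suc.prems(1) assms(4)] .
    ultimately show ?case
      using Suc.IH[of "\<lambda>k. A (X k)" "A x"]
      by (simp add: power_domain_Suc_iff funpow_Suc_right del: funpow.simps)
  qed simp
  show ?thesis
    unfolding closed_sequential_limits
  proof (intro allI impI, elim conjE)
    fix X x assume X: "\<forall>k. X k \<in> ?F" "X \<longlonglongrightarrow> x"
    show "x \<in> ?F"
    proof (rule bounded_vectorsI)
      show "x \<in> power_domain D A n" for n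
        using powers X by blast
      show "norm ((A ^^ n) x) \<le> \<epsilon> ^ n * norm x" for n
      proof (rule LIMSEQ_le)
        show "(\<lambda>k. norm ((A ^^ n) (X k))) \<longlonglongrightarrow> norm ((A ^^ n) x)"
          using powers X by (intro tendsto_norm) blast
        show "(\<lambda>k. \<epsilon> ^ n * norm (X k)) \<longlonglongrightarrow> \<epsilon> ^ n * norm x"
          by (intro tendsto_intros X)
      qed (use X bounded_vectorsD(2) in blast)
    qed
  qed
qed

section \<open>From dense bounded vectors to self-adjointness\<close>

theorem self_adjoint_of_dense_bounded_vectors:
  assumes lin: "linear_operator scaleR D A" and herm: "hermitian_operator ip D A"
    and cl: "closed_operator D A"
    and dense: "closure (\<Union>\<epsilon>\<in>{0<..}. bounded_vectors D A \<epsilon>) = UNIV"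
  shows "self_adjoint_operator ip D A"
proof -
  let ?F = "bounded_vectors D A"
  have approx: "\<exists>\<epsilon>>0. \<exists>u\<in>?F \<epsilon>. norm (x - u) < \<eta>" if \<eta>: "0 < \<eta>" for x and \<eta> :: real
  proof -
    obtain u where "u \<in> (\<Union>\<epsilon>\<in>{0<..}. ?F \<epsilon>)" "dist u x < \<eta>"
      using dense closure_approachable[of x "\<Union>\<epsilon>\<in>{0<..}. ?F \<epsilon>"] \<eta> by (metis UNIV_I)
    then show ?thesis
      by (auto simp: dist_norm norm_minus_commute)
  qed
  have "(\<Union>\<epsilon>\<in>{0<..}. ?F \<epsilon>) \<subseteq> D"
    using bounded_vectors_subset by blast
  then have "closure D = UNIV"
    using dense closure_mono by blast
  moreover have "operator_graph D A \<subseteq> adjoint_graph ip D A"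
    using herm by (auto simp: operator_graph_def adjoint_graph_def hermitian_operator_def)
  moreover have "(y, z) \<in> operator_graph D A" if "(y, z) \<in> adjoint_graph ip D A" for y z
  proof -
    have adj: "ip (A x) y = ip x z" if "x \<in> D" for x
      using \<open>(y, z) \<in> _\<close> that by (simp add: adjoint_graph_def)
    have "\<exists>w\<in>operator_graph D A. dist w (y, z) < \<eta>" if "0 < \<eta>" for \<eta>
    proof -
      obtain \<epsilon>1 u where u: "0 < \<epsilon>1" "u \<in> ?F \<epsilon>1" "norm (y - u) < \<eta> / 2"
        using approx[of "\<eta> / 2" y] \<open>0 < \<eta>\<close> by auto
      obtain \<epsilon>2 v where v: "0 < \<epsilon>2" "v \<in> ?F \<epsilon>2" "norm (z - v) < \<eta> / 2"
        using approx[of "\<eta> / 2" z] \<open>0 < \<eta>\<close> by auto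
      \<comment> \<open>The sets \<open>?F \<epsilon>\<close> grow with \<open>\<epsilon>\<close>,
        so the larger parameter puts both approximants into one closed subspace.\<close>
      define \<epsilon> where "\<epsilon> = max \<epsilon>1 \<epsilon>2"
      have "0 < \<epsilon>" and uv: "u \<in> ?F \<epsilon>" "v \<in> ?F \<epsilon>"
        using u v bounded_vectors_mono[of \<epsilon>1 \<epsilon> D A] bounded_vectors_mono[of \<epsilon>2 \<epsilon> D A]
        by (auto simp: \<epsilon>_def)
      note F = subspace_bounded_vectors[OF lin herm \<open>0 < \<epsilon>\<close>]
        closed_bounded_vectors[OF lin herm cl \<open>0 < \<epsilon>\<close>]
      obtain p where p: "p \<in> ?F \<epsilon>" "\<And>m. m \<in> ?F \<epsilon> \<Longrightarrow> ip (y - p) m = 0"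
        "norm (y - p) \<le> norm (y - u)"
        using orthogonal_projection[OF F, of y] uv(1) by metis
      obtain q where q: "q \<in> ?F \<epsilon>" "\<And>m. m \<in> ?F \<epsilon> \<Longrightarrow> ip (z - q) m = 0"
        "norm (z - q) \<le> norm (z - v)"
        using orthogonal_projection[OF F, of z] uv(2) by metis
      have "p \<in> D"
        using p(1) bounded_vectors_subset by blast
      have Ap: "A p \<in> ?F \<epsilon>"
        using bounded_vectors_invariant[OF herm p(1) \<open>0 < \<epsilon>\<close>] .
      \<comment> \<open>Projection intertwines the adjoint with A: \<open>A p\<close> and q both lie
        in \<open>?F \<epsilon>\<close> and have the same products with every m in it, because
        \<open>A m\<close> stays in \<open>?F \<epsilon>\<close>.\<close>
      have "ip m (A p - q) = 0" if m: "m \<in> ?F \<epsilon>" for m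
      proof -
        have "m \<in> D" using m bounded_vectors_subset by blast
        then have "ip m (A p) = ip (A m) p"
          using herm \<open>p \<in> D\<close> by (simp add: hermitian_operator_def)
        also have "\<dots> = ip (A m) y"
          using p(2)[OF bounded_vectors_invariant[OF herm m \<open>0 < \<epsilon>\<close>]]
          by (simp add: ip.diff_left commute[of "A m"])
        also have "\<dots> = ip m z"
          using adj \<open>m \<in> D\<close> .
        also have "\<dots> = ip m q"
          using q(2)[OF m] by (simp add: ip.diff_left commute[of m])
        finally show ?thesis
          by (simp add: ip.diff_right)
      qed
      then have "ip (A p - q) (A p - q) = 0"
        using Ap q(1) F(1) subspace_diff by blast
      then have "A p = q"
        by (simp add: form_self)
      have "dist (p, A p) (y, z) \<le> norm (y - p) + norm (z - q)"
        using norm_Pair_le[of "p - y" "q - z"] \<open>A p = q\<close>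
        by (simp add: dist_norm norm_minus_commute)
      then have "dist (p, A p) (y, z) < \<eta>"
        using p(3) q(3) u(3) v(3) by linarith
      then show ?thesis
        using \<open>p \<in> D\<close> by (auto simp: operator_graph_def)
    qed
    then have "(y, z) \<in> closure (operator_graph D A)"
      unfolding closure_approachable by blast
    then show ?thesis
      using cl by (simp add: closed_operator_def)
  qed
  ultimately show ?thesis
    by (auto simp: self_adjoint_operator_def)
qed

end

section \<open>Square root of a contraction by iteration\<close>

text \<open>For linear R the iterates are polynomials in R with nonnegative coefficients, and
  \<open>sqrt_majorant n\<close> is the coefficient sum of the n-th one. A fixed point Y satisfies
  (1 - Y)^2 = 1 - R.\<close>

primrec sqrt_iter :: "('a::real_vector \<Rightarrow> 'a) \<Rightarrow> nat \<Rightarrow> 'a \<Rightarrow> 'a" where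
  "sqrt_iter R 0 = (\<lambda>x. 0)"
| "sqrt_iter R (Suc n) = (\<lambda>x. (1/2) *\<^sub>R (R x + sqrt_iter R n (sqrt_iter R n x)))"

primrec sqrt_majorant :: "nat \<Rightarrow> real" where
  "sqrt_majorant 0 = 0"
| "sqrt_majorant (Suc n) = (1 + (sqrt_majorant n)\<^sup>2) / 2"

lemma sqrt_majorant_bounds: "0 \<le> sqrt_majorant n \<and> sqrt_majorant n \<le> 1"
  by (induction n) (auto simp: power_le_one)

lemma sqrt_majorant_Suc: "sqrt_majorant n \<le> sqrt_majorant (Suc n)"
proof (induction n)
  case (Suc n)
  then show ?case
    using sqrt_majorant_bounds power_mono[of "sqrt_majorant n" "sqrt_majorant (Suc n)" 2]
    by (simp only: sqrt_majorant.simps(2)) auto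
qed simp

lemma Cauchy_sqrt_majorant: "Cauchy sqrt_majorant"
proof -
  have "incseq sqrt_majorant"
    by (rule incseq_SucI) (rule sqrt_majorant_Suc)
  then obtain L where "sqrt_majorant \<longlonglongrightarrow> L"
    using incseq_convergent[of sqrt_majorant 1] sqrt_majorant_bounds by blast
  then show ?thesis
    by (rule LIMSEQ_imp_Cauchy)
qed

lemma linear_sqrt_iter:
  assumes "linear R"
  shows "linear (sqrt_iter R n)"
proof (induction n)
  case (Suc n)
  show ?case
    by (rule linearI)
      (simp_all add: linear_add[OF Suc] linear_scale[OF Suc] linear_add[OF assms]
        linear_scale[OF assms] algebra_simps)
qed (simp add: linear_zero)

lemma sqrt_iter_commute:
  assumes "linear T" "\<And>x. T (R x) = R (T x)"
  shows "T (sqrt_iter R n x) = sqrt_iter R n (T x)"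
proof (induction n arbitrary: x)
  case (Suc n)
  then show ?case
    by (simp add: linear_scale[OF assms(1)] linear_add[OF assms(1)] assms(2))
qed (simp add: linear_0[OF assms(1)])

lemma norm_sqrt_iter_le:
  fixes R :: "'a::real_normed_vector \<Rightarrow> 'a"
  assumes "\<And>x. norm (R x) \<le> norm x"
  shows "norm (sqrt_iter R n x) \<le> sqrt_majorant n * norm x"
proof (induction n arbitrary: x)
  case (Suc n)
  let ?y = "sqrt_majorant n"
  have "norm (sqrt_iter R n (sqrt_iter R n x)) \<le> ?y * (?y * norm x)"
    using Suc.IH[of "sqrt_iter R n x"] mult_left_mono[OF Suc.IH[of x], of ?y]
      sqrt_majorant_bounds[of n] by linarith
  moreover have "norm (R x + sqrt_iter R n (sqrt_iter R n x)) \<le>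
      norm (R x) + norm (sqrt_iter R n (sqrt_iter R n x))"
    by (rule norm_triangle_ineq)
  ultimately show ?case
    using assms[of x] unfolding sqrt_iter.simps(2) sqrt_majorant.simps(2) norm_scaleR
    by (simp add: power2_eq_square field_simps)
qed simp

text \<open>Consecutive iterates Y and Y' commute, so Y'^2 - Y^2 = (Y' - Y)(Y' + Y). The induction
  hypothesis bounds the first factor and \<open>norm_sqrt_iter_le\<close> the second; the majorants
  obey the same factorization with equality.\<close>

lemma norm_sqrt_iter_step_le:
  fixes R :: "'a::real_normed_vector \<Rightarrow> 'a"
  assumes lin: "linear R" and norm_R: "\<And>x. norm (R x) \<le> norm x"
  shows "norm (sqrt_iter R (Suc n) x - sqrt_iter R n x)
    \<le> (sqrt_majorant (Suc n) - sqrt_majorant n) * norm x"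
proof (induction n arbitrary: x)
  case 0
  show ?case using norm_R[of x] by simp
next
  case (Suc n)
  define Y Y' y y' where "Y = sqrt_iter R n" and "Y' = sqrt_iter R (Suc n)"
    and "y = sqrt_majorant n" and "y' = sqrt_majorant (Suc n)"
  have linY: "linear Y" "linear Y'"
    by (simp_all add: Y_def Y'_def linear_sqrt_iter[OF lin] del: sqrt_iter.simps)
  have "Y (R v) = R (Y v)" for v
    unfolding Y_def by (rule sqrt_iter_commute[OF lin, symmetric]) simp
  then have comm: "Y (Y' v) = Y' (Y v)" for v
    unfolding Y'_def by (rule sqrt_iter_commute[OF linY(1)])
  define w where "w = Y' x + Y x"
  have "y \<le> y'"
    unfolding y_def y'_def by (rule sqrt_majorant_Suc)
  have "sqrt_iter R (Suc (Suc n)) x - sqrt_iter R (Suc n) x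
      = (1/2) *\<^sub>R (R x + Y' (Y' x)) - (1/2) *\<^sub>R (R x + Y (Y x))"
    by (simp add: Y_def Y'_def)
  also have "\<dots> = (1/2) *\<^sub>R (Y' w - Y w)"
    by (simp add: w_def linear_add[OF linY(1)] linear_add[OF linY(2)] comm algebra_simps)
  finally have "norm (sqrt_iter R (Suc (Suc n)) x - sqrt_iter R (Suc n) x) = norm (Y' w - Y w) / 2"
    by simp
  also have "norm (Y' w - Y w) \<le> (y' - y) * norm w"
    using Suc by (simp add: Y_def Y'_def y_def y'_def del: sqrt_iter.simps sqrt_majorant.simps)
  also have "norm w \<le> y' * norm x + y * norm x"
    using norm_triangle_ineq[of "Y' x" "Y x"] norm_sqrt_iter_le[where R = R, OF norm_R, of n x]
      norm_sqrt_iter_le[where R = R, OF norm_R, of "Suc n" x]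
    unfolding w_def Y_def Y'_def y_def y'_def by linarith
  also have "(y' - y) * (y' * norm x + y * norm x) / 2
      = (sqrt_majorant (Suc (Suc n)) - sqrt_majorant (Suc n)) * norm x"
  proof -
    have "sqrt_majorant (Suc (Suc n)) = (1 + y'\<^sup>2) / 2" "sqrt_majorant (Suc n) = (1 + y\<^sup>2) / 2"
      by (simp_all add: y_def y'_def)
    then show ?thesis
      by (simp only:) (simp add: power2_eq_square field_simps)
  qed
  finally show ?case
    using \<open>y \<le> y'\<close> by (simp add: divide_right_mono mult_left_mono)
qed

lemma norm_sqrt_iter_diff_le:
  fixes R :: "'a::real_normed_vector \<Rightarrow> 'a"
  assumes "linear R" and "\<And>x. norm (R x) \<le> norm x"
  shows "norm (sqrt_iter R m x - sqrt_iter R n x) \<le> norm x * norm (sqrt_majorant m - sqrt_majorant n)"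
proof -
  have *: "norm (sqrt_iter R m x - sqrt_iter R n x) \<le> (sqrt_majorant m - sqrt_majorant n) * norm x"
    if "n \<le> m" for m n
    using that
  proof (induction rule: dec_induct)
    case (step k)
    have "norm (sqrt_iter R (Suc k) x - sqrt_iter R n x) \<le>
        norm (sqrt_iter R (Suc k) x - sqrt_iter R k x) + norm (sqrt_iter R k x - sqrt_iter R n x)"
      using norm_triangle_ineq[of "sqrt_iter R (Suc k) x - sqrt_iter R k x"
          "sqrt_iter R k x - sqrt_iter R n x"] by (simp del: sqrt_iter.simps)
    then show ?case
      using step.IH norm_sqrt_iter_step_le[OF assms, of k x] by (simp add: left_diff_distrib)
  qed simp
  have mono: "sqrt_majorant n \<le> sqrt_majorant m" if "n \<le> m" for m n
    using that by (rule lift_Suc_mono_le[of sqrt_majorant, OF sqrt_majorant_Suc])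
  show ?thesis
  proof (cases "n \<le> m")
    case True
    then show ?thesis using *[OF True] mono[OF True] by (simp add: mult.commute)
  next
    case False
    then show ?thesis
      using *[of m n] mono[of m n] by (simp add: norm_minus_commute mult.commute)
  qed
qed

text \<open>\<open>Y = 1 - sqrt (1 - R)\<close> solves \<open>Y = (R + Y\<^sup>2) / 2\<close>; the iteration of this equation is dominated
  termwise by the scalar iteration for \<open>R = 1\<close>, which is increasing and bounded.\<close>

lemma contraction_square_root:
  fixes R :: "'a::{real_normed_vector, complete_space} \<Rightarrow> 'a"
  assumes lin: "linear R" and norm_R: "\<And>x. norm (R x) \<le> norm x"
  obtains Y where "linear Y" "\<And>x. (\<lambda>n. sqrt_iter R n x) \<longlonglongrightarrow> Y x" "\<And>x. norm (Y x) \<le> norm x"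
    "\<And>x. 2 *\<^sub>R Y x = R x + Y (Y x)"
proof -
  have "Cauchy (\<lambda>n. sqrt_iter R n x)" for x
    by (rule Cauchy_of_norm_le[OF norm_sqrt_iter_diff_le[OF assms] Cauchy_sqrt_majorant])
  then have "\<exists>y. (\<lambda>n. sqrt_iter R n x) \<longlonglongrightarrow> y" for x
    using Cauchy_convergent convergent_def by blast
  then obtain Y where Y: "\<And>x. (\<lambda>n. sqrt_iter R n x) \<longlonglongrightarrow> Y x"
    by metis
  note lin_iter = linear_sqrt_iter[OF lin]
  have "linear Y"
  proof (rule linearI)
    show "Y (x + y) = Y x + Y y" for x y
      using Y[of "x + y"] tendsto_add[OF Y Y, of x y]
      by (simp add: linear_add[OF lin_iter] LIMSEQ_unique)
    show "Y (c *\<^sub>R x) = c *\<^sub>R Y x" for c x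
      using Y[of "c *\<^sub>R x"] tendsto_scaleR[OF tendsto_const Y, of c x]
      by (simp add: linear_scale[OF lin_iter] LIMSEQ_unique)
  qed
  have iter_le: "norm (sqrt_iter R n x) \<le> norm x" for n x
    using norm_sqrt_iter_le[where R = R, OF norm_R, of n x] sqrt_majorant_bounds[of n]
      mult_right_mono[of "sqrt_majorant n" 1 "norm x"] by simp
  have norm_Y: "norm (Y x) \<le> norm x" for x
    by (rule LIMSEQ_le_const2[OF tendsto_norm[OF Y]]) (use iter_le in blast)
  have "2 *\<^sub>R Y x = R x + Y (Y x)" for x
  proof -
    \<comment> \<open>Pointwise convergence passes to the square of the iterates because they are
      uniformly contractive: the n-th iterate of \<open>Y x\<close> differs from the n-th iterate
      applied twice to x by a term tending to 0.\<close>
    have "(\<lambda>n. sqrt_iter R n (sqrt_iter R n x - Y x)) \<longlonglongrightarrow> 0"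
    proof (rule Lim_null_comparison)
      show "(\<lambda>n. norm (sqrt_iter R n x - Y x)) \<longlonglongrightarrow> 0"
        using Y[of x] by (simp add: LIM_zero tendsto_norm_zero)
    qed (simp add: iter_le)
    from tendsto_add[OF this Y[of "Y x"]]
    have "(\<lambda>n. sqrt_iter R n (sqrt_iter R n x)) \<longlonglongrightarrow> Y (Y x)"
      by (simp add: linear_diff[OF lin_iter])
    then have "(\<lambda>n. 2 *\<^sub>R sqrt_iter R (Suc n) x) \<longlonglongrightarrow> R x + Y (Y x)"
      by (simp add: tendsto_add)
    moreover have "(\<lambda>n. 2 *\<^sub>R sqrt_iter R (Suc n) x) \<longlonglongrightarrow> 2 *\<^sub>R Y x"
      by (intro tendsto_scaleR tendsto_const LIMSEQ_Suc Y)
    ultimately show ?thesis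
      by (metis LIMSEQ_unique)
  qed
  with that \<open>linear Y\<close> Y norm_Y show thesis
    by blast
qed

section \<open>Absolute value and lower bounds for bounded symmetric operators\<close>

context real_inner_form
begin

lemma sqrt_iter_symmetric:
  assumes "\<And>x y. ip (R x) y = ip x (R y)"
  shows "ip (sqrt_iter R n x) y = ip x (sqrt_iter R n y)"
proof (induction n arbitrary: x y)
  case (Suc n)
  then show ?case
    by (simp add: form_scale_left form_scale_right form_add_left form_add_right assms)
qed (simp add: ip.zero_left ip.zero_right)

text \<open>C is the square root of B^2, taken as 1 - Y for R = 1 - B^2. As a pointwise limit of
  polynomials in B it inherits symmetry and commutes with every bounded T that commutes with B; it
  is nonnegative because Y is a contraction.\<close>

lemma symmetric_absolute_value:
  assumes lin: "linear B" and norm_B: "\<And>x. norm (B x) \<le> norm x"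
    and sym: "\<And>x y. ip (B x) y = ip x (B y)"
  obtains C where "linear C" "\<And>x y. ip (C x) y = ip x (C y)" "\<And>x. 0 \<le> ip (C x) x"
    "\<And>x. C (C x) = B (B x)"
    "\<And>T x. bounded_linear T \<Longrightarrow> (\<And>x. T (B x) = B (T x)) \<Longrightarrow> T (C x) = C (T x)"
proof -
  define R where "R x = x - B (B x)" for x
  have lin_R: "linear R"
    by (rule linearI) (simp_all add: R_def linear_add[OF lin] linear_scale[OF lin] algebra_simps)
  have sym_R: "ip (R x) y = ip x (R y)" for x y
    by (simp add: R_def ip.diff_left ip.diff_right sym)
  \<comment> \<open>The squared norm of \<open>R x\<close> is that of x, minus twice that of
    \<open>B x\<close>, plus that of \<open>B (B x)\<close>, and the last is at most that of
    \<open>B x\<close>.\<close>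
  have norm_R: "norm (R x) \<le> norm x" for x
  proof (rule power2_le_imp_le)
    have "(norm (B (B x)))\<^sup>2 \<le> (norm (B x))\<^sup>2"
      using norm_B by (intro power_mono) auto
    moreover have "ip x (B (B x)) = (norm (B x))\<^sup>2"
      by (simp add: sym[symmetric] form_self)
    ultimately show "(norm (R x))\<^sup>2 \<le> (norm x)\<^sup>2"
      unfolding R_def norm_diff_sq by (smt (verit) zero_le_power2)
  qed simp
  obtain Y where Y: "linear Y" "\<And>x. (\<lambda>n. sqrt_iter R n x) \<longlonglongrightarrow> Y x" "\<And>x. norm (Y x) \<le> norm x"
    "\<And>x. 2 *\<^sub>R Y x = R x + Y (Y x)"
    using contraction_square_root[OF lin_R norm_R] by blast
  have sym_Y: "ip (Y x) y = ip x (Y y)" for x y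
  proof (rule LIMSEQ_unique)
    show "(\<lambda>n. ip (sqrt_iter R n x) y) \<longlonglongrightarrow> ip (Y x) y"
      by (intro ip.tendsto Y tendsto_const)
    show "(\<lambda>n. ip (sqrt_iter R n x) y) \<longlonglongrightarrow> ip x (Y y)"
      unfolding sqrt_iter_symmetric[where R = R, OF sym_R] by (intro ip.tendsto Y tendsto_const)
  qed
  show thesis
  proof (rule that[of "\<lambda>x. x - Y x"])
    show "linear (\<lambda>x. x - Y x)"
      by (intro linear_compose_sub Y linear_ident)
    show "ip (x - Y x) y = ip x (y - Y y)" for x y
      by (simp add: ip.diff_left ip.diff_right sym_Y)
    show "0 \<le> ip (x - Y x) x" for x
    proof -
      have "ip (Y x) x \<le> norm x * norm x"
        using Cauchy_Schwarz[of "Y x" x] mult_right_mono[OF Y(3)[of x], of "norm x"] by simp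
      then show ?thesis
        by (simp add: ip.diff_left form_self power2_eq_square)
    qed
    show "x - Y x - Y (x - Y x) = B (B x)" for x
      using Y(4)[of x] by (simp add: linear_diff[OF Y(1)] R_def scaleR_2 algebra_simps)
    fix T x assume T: "bounded_linear T" "\<And>x. T (B x) = B (T x)"
    interpret T: bounded_linear T by fact
    have "T (R v) = R (T v)" for v
      by (simp add: R_def T.diff T(2))
    then have "(\<lambda>n. sqrt_iter R n (T x)) \<longlonglongrightarrow> T (Y x)"
      using T.tendsto[OF Y(2), of x] by (simp add: sqrt_iter_commute[OF T.linear])
    then have "T (Y x) = Y (T x)"
      using Y(2) LIMSEQ_unique by blast
    then show "T (x - Y x) = T x - Y (T x)"
      by (simp add: T.diff)
  qed
qed

text \<open>With \<open>B\<close> a multiple of \<open>\<delta>\<^sup>2 - T\<^sup>2\<close> and \<open>C = \<bar>B\<bar>\<close>, the identity \<open>(C - B) (C + B) = 0\<close> shows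
  \<open>\<parallel>T y\<parallel> \<le> \<delta> \<parallel>y\<parallel>\<close> for \<open>y\<close> in the \<open>T\<close>-invariant range of \<open>C + B\<close>.  A vector \<open>x\<close> orthogonal to
  this range satisfies \<open>B x = - C x\<close>, hence \<open>\<parallel>T x\<parallel> \<ge> \<delta> \<parallel>x\<parallel>\<close>.\<close>

lemma bounded_below_on_complement:
  assumes "bounded_linear T" and sym: "\<And>x y. ip (T x) y = ip x (T y)" and "0 < \<delta>"
    and perp: "\<And>f. f \<in> bounded_vectors UNIV T \<delta> \<Longrightarrow> ip x f = 0"
  shows "\<delta> * norm x \<le> norm (T x)"
proof -
  interpret T: bounded_linear T by fact
  obtain K where K: "0 < K" "\<And>x. norm (T x) \<le> norm x * K"
    using T.pos_bounded by blast
  \<comment> \<open>This factor makes B a contraction, as the absolute value requires.\<close>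
  define s where "s = 1 / (\<delta>\<^sup>2 + K\<^sup>2)"
  have "0 < s"
    using \<open>0 < \<delta>\<close> by (simp add: s_def add_pos_nonneg)
  define B where "B x = s *\<^sub>R (\<delta>\<^sup>2 *\<^sub>R x - T (T x))" for x
  have norm_B: "norm (B x) \<le> norm x" for x
  proof -
    have "norm (T (T x)) \<le> norm x * K * K"
      using K(2)[of "T x"] mult_right_mono[OF K(2)[of x], of K] K(1) by linarith
    then have "norm (\<delta>\<^sup>2 *\<^sub>R x - T (T x)) \<le> (\<delta>\<^sup>2 + K\<^sup>2) * norm x"
      using norm_triangle_ineq4[of "\<delta>\<^sup>2 *\<^sub>R x" "T (T x)"] by (simp add: power2_eq_square algebra_simps)
    then have "s * norm (\<delta>\<^sup>2 *\<^sub>R x - T (T x)) \<le> s * ((\<delta>\<^sup>2 + K\<^sup>2) * norm x)"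
      using \<open>0 < s\<close> by (intro mult_left_mono) auto
    also have "\<dots> = norm x"
      using K(1) by (simp add: s_def)
    finally show ?thesis
      using \<open>0 < s\<close> by (simp add: B_def)
  qed
  have lin_B: "linear B"
    by (rule linearI) (simp_all add: B_def T.add T.scale algebra_simps)
  then have bl_B: "bounded_linear B"
    using norm_B by (intro bounded_linear_intro[where K = 1]) (auto simp: linear_add linear_scale)
  have sym_B: "ip (B x) y = ip x (B y)" for x y
    by (simp add: B_def form_scale_left form_scale_right ip.diff_left ip.diff_right sym)
  have TB: "T (B x) = B (T x)" for x
    by (simp add: B_def T.diff T.scale)
  \<comment> \<open>The sign of this form decides whether \<open>norm (T x)\<close> lies below or
    above \<open>\<delta> * norm x\<close>.\<close>
  have B_form: "ip (B x) x = s * ((\<delta> * norm x)\<^sup>2 - (norm (T x))\<^sup>2)" for x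
    by (simp add: B_def form_scale_left ip.diff_left sym[of "T x"] form_self power_mult_distrib)
  obtain C where C: "linear C" "\<And>x y. ip (C x) y = ip x (C y)" "\<And>x. 0 \<le> ip (C x) x"
    "\<And>x. C (C x) = B (B x)"
    "\<And>T x. bounded_linear T \<Longrightarrow> (\<And>x. T (B x) = B (T x)) \<Longrightarrow> T (C x) = C (T x)"
    using symmetric_absolute_value[OF lin_B norm_B sym_B] by blast
  have TC: "T (C x) = C (T x)" and BC: "B (C x) = C (B x)" for x
    using C(5) T.bounded_linear_axioms TB bl_B by blast+
  have T_le: "norm (T (C z + B z)) \<le> \<delta> * norm (C z + B z)" for z
  proof -
    define y where "y = C z + B z"
    \<comment> \<open>B and C commute and have equal squares, so B (C + B) = C (C + B).\<close>
    have "B y = C y"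
      by (simp add: y_def linear_add[OF lin_B] linear_add[OF C(1)] C(4) BC)
    then have "0 \<le> s * ((\<delta> * norm y)\<^sup>2 - (norm (T y))\<^sup>2)"
      using C(3)[of y] B_form[of y] by simp
    then have "(norm (T y))\<^sup>2 \<le> (\<delta> * norm y)\<^sup>2"
      using \<open>0 < s\<close> by (simp add: zero_le_mult_iff)
    then have "norm (T y) \<le> \<delta> * norm y"
      by (rule power2_le_imp_le) (use \<open>0 < \<delta>\<close> in simp)
    then show ?thesis
      by (simp only: y_def)
  qed
  \<comment> \<open>T commutes with C and B, so all its powers preserve the range of C + B and
    \<open>T_le\<close> applies at each of them.\<close>
  have power_T: "(T ^^ n) (C z + B z) = C ((T ^^ n) z) + B ((T ^^ n) z)" for n z
    by (induction n) (auto simp: T.add TB TC)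
  have in_F: "C z + B z \<in> bounded_vectors UNIV T \<delta>" for z
  proof (rule bounded_vectorsI)
    fix n
    show "C z + B z \<in> power_domain UNIV T n"
      by (induction n) (auto simp: power_domain.simps)
    show "norm ((T ^^ n) (C z + B z)) \<le> \<delta> ^ n * norm (C z + B z)"
    proof (induction n)
      case (Suc n)
      have "norm ((T ^^ Suc n) (C z + B z)) \<le> \<delta> * norm ((T ^^ n) (C z + B z))"
        using T_le[of "(T ^^ n) z"] by (simp add: power_T)
      also have "\<dots> \<le> \<delta> * (\<delta> ^ n * norm (C z + B z))"
        using Suc \<open>0 < \<delta>\<close> by simp
      finally show ?case
        by (simp add: mult_ac)
    qed simp
  qed
  define w where "w = C x + B x"
  \<comment> \<open>Symmetry of C + B moves it off x; the result is a product of x with a vector of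
    the range, which vanishes by \<open>perp\<close>.\<close>
  have "ip w w = ip x (C w + B w)"
    by (simp add: form_add_right C(2)[symmetric] sym_B[symmetric]) (simp add: w_def form_add_left)
  then have "w = 0"
    using perp[OF in_F] by (simp add: form_self)
  then have "ip (C x) x + ip (B x) x = 0"
    unfolding w_def by (metis form_add_left ip.zero_left)
  then have "s * ((\<delta> * norm x)\<^sup>2 - (norm (T x))\<^sup>2) \<le> 0"
    using C(3)[of x] B_form[of x] by linarith
  then have "(\<delta> * norm x)\<^sup>2 \<le> (norm (T x))\<^sup>2"
    using \<open>0 < s\<close> by (simp add: mult_le_0_iff)
  then show ?thesis
    by (rule power2_le_imp_le) simp
qed

text \<open>The complement K is closed and invariant under T, and T is bounded below on it, so the
  image of K is closed. For u in K orthogonal to that image, symmetry gives T u = 0 and the lower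
  bound gives u = 0; this applies to x minus its projection to the image.\<close>

lemma surjective_on_complement:
  assumes "bounded_linear T" and sym: "\<And>x y. ip (T x) y = ip x (T y)" and "0 < \<delta>"
    and x: "\<And>f. f \<in> bounded_vectors UNIV T \<delta> \<Longrightarrow> ip x f = 0"
  obtains y where "T y = x" "\<forall>f\<in>bounded_vectors UNIV T \<delta>. ip y f = 0"
    "\<delta> * norm y \<le> norm x"
proof -
  interpret T: bounded_linear T by fact
  define K where "K = {x. \<forall>f\<in>bounded_vectors UNIV T \<delta>. ip x f = 0}"
  have "hermitian_operator ip UNIV T"
    using sym by (simp add: hermitian_operator_def)
  then have T_K: "T k \<in> K" if "k \<in> K" for k
    using that bounded_vectors_invariant \<open>0 < \<delta>\<close> by (auto simp: K_def sym)
  have below: "\<delta> * norm k \<le> norm (T k)" if "k \<in> K" for k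
    using bounded_below_on_complement[OF assms(1-3)] that by (auto simp: K_def)
  have "subspace K"
    by (rule subspaceI) (auto simp: K_def ip.zero_left form_add_left form_scale_left)
  have "K = (\<Inter>f\<in>bounded_vectors UNIV T \<delta>. {x. ip x f = 0})"
    by (auto simp: K_def)
  moreover have "closed {x. ip x f = 0}" for f
    by (intro closed_Collect_eq continuous_intros
        linear_continuous_on[OF ip.bounded_linear_left])
  ultimately have "closed K"
    by (simp add: closed_INT)
  then have "complete (T ` K)"
    using below \<open>0 < \<delta>\<close> \<open>subspace K\<close> assms(1) complete_eq_closed
    by (intro complete_isometric_image[where e = \<delta>]) auto
  then have "closed (T ` K)"
    by (rule complete_imp_closed)
  moreover have "subspace (T ` K)"
    using T.linear \<open>subspace K\<close> by (rule linear_subspace_image)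
  ultimately obtain p where p: "p \<in> T ` K" "\<And>m. m \<in> T ` K \<Longrightarrow> ip (x - p) m = 0"
    using orthogonal_projection by metis
  then have "x - p \<in> K"
    using x T_K \<open>subspace K\<close> by (intro subspace_diff) (auto simp: K_def)
  then have "ip (T (x - p)) (T (x - p)) = 0"
    using p(2) T_K by (simp add: sym)
  then have "x - p = 0"
    using below[OF \<open>x - p \<in> K\<close>] \<open>0 < \<delta>\<close> by (simp add: form_self mult_le_0_iff)
  then obtain y where "y \<in> K" "T y = x"
    using p(1) by auto
  with that below show thesis
    by (auto simp: K_def)
qed

section \<open>The operator (1 + A^2)^-1\<close>

text \<open>Makes orthogonal projection available in the product space, where the graph of A is a
  closed subspace.\<close>

lemma product_form:
  "real_inner_form (\<lambda>p q :: 'a \<times> 'a. ip (fst p) (fst q) + ip (snd p) (snd q))"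
proof
  show "ip (fst x) (fst x) + ip (snd x) (snd x) = (norm x)\<^sup>2" for x :: "'a \<times> 'a"
    by (simp add: norm_prod_def form_self)
  show "ip (fst x) (fst y) + ip (snd x) (snd y) = ip (fst y) (fst x) + ip (snd y) (snd x)"
    for x y :: "'a \<times> 'a"
    by (metis commute)
qed (auto simp: form_add_left form_scale_left algebra_simps)

lemma subspace_operator_graph:
  fixes D :: "'a set"
  assumes "linear_operator scaleR D A"
  shows "subspace (operator_graph D A)"
  using linear_operatorD[OF assms] subspace_0[of D] subspace_add[of D] subspace_scale[of D]
    linear_operator_zero[OF assms]
  by (intro subspaceI) (auto simp: operator_graph_def zero_prod_def)

text \<open>The first component of the orthogonal projection of \<open>(h, 0)\<close> onto the graph of \<open>A\<close> is
  \<open>(1 + A\<^sup>2)\<^sup>-\<^sup>1 h\<close>.\<close>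

lemma self_adjoint_resolvent:
  assumes lin: "linear_operator scaleR D A" and cl: "closed_operator D A"
    and sa: "self_adjoint_operator ip D A"
  obtains T where "bounded_linear T" "\<And>x y. ip (T x) y = ip x (T y)"
    "\<And>h. T h \<in> D" "\<And>h. A (T h) \<in> D" "\<And>h. T h + A (A (T h)) = h"
proof -
  have graph: "operator_graph D A = adjoint_graph ip D A"
    using sa by (simp add: self_adjoint_operator_def)
  then have herm: "ip (A x) y = ip x (A y)" if "x \<in> D" "y \<in> D" for x y
    using that by (auto simp: operator_graph_def adjoint_graph_def)
  have "\<exists>x. x \<in> D \<and> A x \<in> D \<and> x + A (A x) = h" for h
  proof -
    obtain p where p: "p \<in> operator_graph D A"
      "\<And>m. m \<in> operator_graph D A \<Longrightarrow> ip (fst ((h, 0) - p)) (fst m) + ip (snd ((h, 0) - p)) (snd m) = 0"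
      using real_inner_form.orthogonal_projection[OF product_form subspace_operator_graph[OF lin],
          of "(h, 0)"] cl
      unfolding closed_operator_def by metis
    then obtain x where x: "x \<in> D" "p = (x, A x)"
      by (auto simp: operator_graph_def)
    \<comment> \<open>Orthogonality of (h, 0) - (x, A x) to (u, A u), read as membership of (A x, h
      - x) in the adjoint graph.\<close>
    have "ip (A u) (A x) = ip u (h - x)" if "u \<in> D" for u
      using p(2)[of "(u, A u)"] that x
      by (auto simp: operator_graph_def ip.minus_left commute[of u] commute[of "A u"])
    then have "(A x, h - x) \<in> operator_graph D A"
      by (simp add: graph adjoint_graph_def)
    then have "A x \<in> D" "A (A x) = h - x"
      by (auto simp: operator_graph_def)
    with x(1) show ?thesis by (intro exI[of _ x]) simp
  qed
  then obtain T where T: "\<And>h. T h \<in> D" "\<And>h. A (T h) \<in> D" "\<And>h. T h + A (A (T h)) = h"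
    by metis
  \<comment> \<open>Write y as T y + A^2 T y and move one A across. The right-hand side is symmetric
    in x and y, and for y = x it dominates the squared norm of \<open>T x\<close>.\<close>
  have T_form: "ip (T x) y = ip (T x) (T y) + ip (A (T x)) (A (T y))" for x y
    by (subst T(3)[of y, symmetric]) (simp only: form_add_right herm T(1,2))
  have sym: "ip (T x) y = ip x (T y)" for x y
    using T_form[of x y] T_form[of y x] commute by metis
  have eqI: "u = v" if "\<And>y. ip u y = ip v y" for u v
  proof -
    have "ip (u - v) (u - v) = 0"
      using that by (simp add: ip.diff_left)
    then show ?thesis by (simp add: form_self)
  qed
  \<comment> \<open>T was only chosen pointwise; its linearity follows from symmetry, by testing
    against all vectors.\<close>
  have "bounded_linear T"
  proof (rule bounded_linear_intro[where K = 1])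
    show "T (x + y) = T x + T y" for x y
      by (rule eqI) (simp add: form_add_left sym)
    show "T (c *\<^sub>R x) = c *\<^sub>R T x" for c x
      by (rule eqI) (simp add: form_scale_left sym)
    show "norm (T x) \<le> norm x * 1" for x
    proof -
      have "(norm (T x))\<^sup>2 \<le> ip (T x) x"
        using T_form[of x x] by (simp add: form_self)
      also have "\<dots> \<le> norm (T x) * norm x"
        by (rule Cauchy_Schwarz)
      finally show ?thesis
        by (cases "T x = 0") (auto simp: power2_eq_square)
    qed
  qed
  with that sym T show thesis by blast
qed

section \<open>From self-adjointness to dense bounded vectors\<close>

theorem dense_bounded_vectors_of_self_adjoint:
  assumes lin: "linear_operator scaleR D A" and herm: "hermitian_operator ip D A"
    and cl: "closed_operator D A" and sa: "self_adjoint_operator ip D A"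
  shows "closure (\<Union>\<epsilon>\<in>{0<..}. bounded_vectors D A \<epsilon>) = UNIV"
proof -
  obtain T where T: "bounded_linear T" "\<And>x y. ip (T x) y = ip x (T y)"
    "\<And>h. T h \<in> D" "\<And>h. A (T h) \<in> D" "\<And>h. T h + A (A (T h)) = h"
    using self_adjoint_resolvent[OF lin cl sa] by blast
  interpret T: bounded_linear T by fact
  let ?F = "bounded_vectors UNIV T"
  define K where "K \<delta> = {x. \<forall>f\<in>?F \<delta>. ip x f = 0}" for \<delta>
  have K_subset: "K \<delta> \<subseteq> bounded_vectors D A (sqrt (1 / \<delta> + 1))" if "0 < \<delta>" for \<delta>
  proof
    \<comment> \<open>On \<open>K \<delta>\<close> the inverse of T is bounded by
      \<open>1 / \<delta>\<close>, so A^2 is bounded by \<open>1 / \<delta> + 1\<close>, and A by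
      the square root of that.\<close>
    let ?c = "sqrt (1 / \<delta> + 1)"
    have c: "0 \<le> ?c" "?c\<^sup>2 = 1 / \<delta> + 1"
      using \<open>0 < \<delta>\<close> by simp_all
    have square: "x \<in> D \<and> A x \<in> D \<and> A (A x) \<in> K \<delta> \<and> norm (A (A x)) \<le> ?c\<^sup>2 * norm x
        \<and> norm (A x) \<le> ?c * norm x" if x_K: "x \<in> K \<delta>" for x
    proof -
      have perp: "ip x f = 0" if "f \<in> ?F \<delta>" for f
        using x_K that by (simp add: K_def)
      obtain y where Ty: "T y = x" and y_perp: "\<forall>f\<in>?F \<delta>. ip y f = 0"
        and norm_y: "\<delta> * norm y \<le> norm x"
        using surjective_on_complement[OF T(1,2) \<open>0 < \<delta>\<close> perp] by blast
      have x: "x \<in> D" "A x \<in> D" and AA: "A (A x) = y - x"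
        using T(3)[of y] T(4)[of y] T(5)[of y] by (auto simp: Ty eq_diff_eq add.commute)
      have "norm y \<le> norm x / \<delta>"
        using norm_y \<open>0 < \<delta>\<close> by (simp add: field_simps)
      then have AA_le: "norm (A (A x)) \<le> ?c\<^sup>2 * norm x"
        using norm_triangle_ineq4[of y x] unfolding AA c(2) by (simp add: algebra_simps)
      have "(norm (A x))\<^sup>2 = ip x (A (A x))"
        using herm x by (simp add: form_self[symmetric] hermitian_operator_def)
      also have "\<dots> \<le> norm x * norm (A (A x))"
        by (rule Cauchy_Schwarz)
      also have "\<dots> \<le> norm x * (?c\<^sup>2 * norm x)"
        using AA_le by (intro mult_left_mono) auto
      also have "\<dots> = (?c * norm x)\<^sup>2"
        by (simp only: power_mult_distrib) (simp add: power2_eq_square)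
      finally have "norm (A x) \<le> ?c * norm x"
        by (rule power2_le_imp_le) (use c(1) in simp)
      moreover have "A (A x) \<in> K \<delta>"
        using y_perp x_K unfolding AA K_def by (simp add: ip.diff_left)
      ultimately show ?thesis
        using x AA_le by blast
    qed
    \<comment> \<open>The induction advances by two because \<open>square\<close> places A^2 x, but
      not A x, in \<open>K \<delta>\<close>.\<close>
    have powers: "x \<in> power_domain D A n \<and> norm ((A ^^ n) x) \<le> ?c ^ n * norm x"
      if "x \<in> K \<delta>" for x n
      using that
    proof (induction n arbitrary: x rule: induct_nat_012)
      case 0
      then show ?case by simp
    next
      case 1
      then show ?case
        using square by (simp add: power_domain_Suc_iff)
    next
      case (ge2 n)
      note x = square[OF ge2.prems] and IH = ge2.IH(1)[of "A (A x)"]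
      have "norm ((A ^^ n) (A (A x))) \<le> ?c ^ n * (?c\<^sup>2 * norm x)"
        using IH x mult_left_mono[of "norm (A (A x))" "?c\<^sup>2 * norm x" "?c ^ n"] c(1)
        by (smt (verit) zero_le_power)
      then show ?case
        using IH x by (simp add: power_domain_Suc_iff funpow_Suc_right power2_eq_square mult_ac
            del: funpow.simps real_sqrt_pow2_iff real_sqrt_mult_self)
    qed
    fix x assume "x \<in> K \<delta>"
    then show "x \<in> bounded_vectors D A ?c"
      using powers by (intro bounded_vectorsI) blast+
  qed
  define U where "U = (\<Union>\<delta>\<in>{0<..}. K \<delta>)"
  have K_mono: "K \<epsilon> \<subseteq> K \<delta>" if "0 < \<delta>" "\<delta> \<le> \<epsilon>" for \<delta> \<epsilon>
    using bounded_vectors_mono[of \<delta> \<epsilon> UNIV T] that by (auto simp: K_def)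
  \<comment> \<open>\<open>K \<delta>\<close> grows as \<open>\<delta>\<close> decreases, so two
    vectors of the union lie in a common member.\<close>
  have "subspace U"
  proof (rule subspaceI)
    show "0 \<in> U"
      by (simp add: U_def K_def ip.zero_left gt_ex)
    fix x y assume "x \<in> U" "y \<in> U"
    then obtain \<delta> \<epsilon> where \<delta>: "0 < \<delta>" "0 < \<epsilon>" "x \<in> K \<delta>" "y \<in> K \<epsilon>"
      by (auto simp: U_def)
    then have "x \<in> K (min \<delta> \<epsilon>)" "y \<in> K (min \<delta> \<epsilon>)"
      using K_mono[of "min \<delta> \<epsilon>" \<delta>] K_mono[of "min \<delta> \<epsilon>" \<epsilon>] by auto
    then have "x + y \<in> K (min \<delta> \<epsilon>)"
      by (simp add: K_def form_add_left)
    with \<delta> show "x + y \<in> U"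
      by (auto simp: U_def intro!: bexI[of _ "min \<delta> \<epsilon>"])
  qed (auto simp: U_def K_def form_scale_left)
  moreover have "z = 0" if perp: "\<And>m. m \<in> U \<Longrightarrow> ip z m = 0" for z
  proof -
    \<comment> \<open>Viewed as an everywhere defined closed Hermitian operator, T has closed
      subspaces of bounded vectors too, as the double complement argument requires.\<close>
    have lin_T: "linear_operator scaleR UNIV T"
      using T.linear by (simp add: linear_operator_def subspace_raw_def[symmetric] T.add T.scale)
    have herm_T: "hermitian_operator ip UNIV T"
      using T(2) by (simp add: hermitian_operator_def)
    have "operator_graph UNIV T = {p. snd p = T (fst p)}"
      by (auto simp: operator_graph_def)
    moreover have "closed {p. snd p = T (fst p)}"
      by (intro closed_Collect_eq continuous_intros T.continuous_on)
    ultimately have cl_T: "closed_operator UNIV T"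
      by (simp add: closed_operator_def)
    have in_F: "z \<in> ?F \<delta>" if "0 < \<delta>" for \<delta>
    proof (rule double_complement)
      show "subspace (?F \<delta>)" "closed (?F \<delta>)"
        using subspace_bounded_vectors[OF lin_T herm_T that]
          closed_bounded_vectors[OF lin_T herm_T cl_T that] by blast+
      fix k assume "\<And>m. m \<in> ?F \<delta> \<Longrightarrow> ip k m = 0"
      then have "k \<in> U"
        using that by (auto simp: U_def K_def)
      then show "ip z k = 0"
        by (rule perp)
    qed
    \<comment> \<open>Membership of z in every \<open>?F d\<close> bounds \<open>norm (T z)\<close>
      by \<open>d * norm z\<close> for all d > 0. Then T z = 0, and z = T z + A^2 T z
      vanishes.\<close>
    have "norm (T z) \<le> 0"
    proof (rule field_le_epsilon)
      fix e :: real assume "0 < e"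
      define d where "d = e / (norm z + 1)"
      have "0 < d"
        using \<open>0 < e\<close> by (simp add: d_def add_nonneg_pos)
      have "norm (T z) \<le> d * norm z"
        using bounded_vectors_norm_le[OF in_F[OF \<open>0 < d\<close>]] .
      also have "\<dots> \<le> d * (norm z + 1)"
        using \<open>0 < d\<close> by simp
      also have "\<dots> = e"
        by (simp add: d_def add_nonneg_eq_0_iff)
      finally show "norm (T z) \<le> 0 + e" by simp
    qed
    then show "z = 0"
      using T(5)[of z] linear_operator_zero[OF lin] by simp
  qed
  ultimately have "closure U = UNIV"
    by (rule dense_subspaceI)
  moreover have "U \<subseteq> (\<Union>\<epsilon>\<in>{0<..}. bounded_vectors D A \<epsilon>)"
  proof
    fix x assume "x \<in> U"
    then obtain \<delta> where "0 < \<delta>" "x \<in> K \<delta>"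
      by (auto simp: U_def)
    then have "x \<in> bounded_vectors D A (sqrt (1 / \<delta> + 1))" "0 < sqrt (1 / \<delta> + 1)"
      using K_subset by (auto simp: add_pos_pos)
    then show "x \<in> (\<Union>\<epsilon>\<in>{0<..}. bounded_vectors D A \<epsilon>)"
      by blast
  qed
  ultimately show ?thesis
    using closure_mono by blast
qed

lemma dense_bounded_vectors_iff_self_adjoint:
  assumes "linear_operator scaleR D A" "closed_operator D A" "hermitian_operator ip D A"
  shows "closure (\<Union>\<epsilon>\<in>{0<..}. bounded_vectors D A \<epsilon>) = UNIV \<longleftrightarrow> self_adjoint_operator ip D A"
  using self_adjoint_of_dense_bounded_vectors dense_bounded_vectors_of_self_adjoint assms by blast

end

section \<open>Real and complex Hilbert spaces\<close>

lemma real_inner_form_inner: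
  "real_inner_form (inner :: 'a::{real_inner, complete_space} \<Rightarrow> 'a \<Rightarrow> real)"
  by standard (rule inner_commute, simp_all add: inner_add_left power2_norm_eq_inner)

lemma real_inner_form_Re_cinner:
  "real_inner_form (\<lambda>x y :: 'b::complex_hilbert_space. Re (cinner x y))"
proof
  fix x y z :: 'b and c :: real
  show "Re (cinner x y) = Re (cinner y x)"
    by (subst cinner_commute) simp
  show "Re (cinner (x + y) z) = Re (cinner x z) + Re (cinner y z)"
    by (simp add: cinner_add_left)
  show "Re (cinner (c *\<^sub>R x) y) = c * Re (cinner x y)"
    by (simp add: scaleC_of_real[symmetric] cinner_scaleC_left)
  show "Re (cinner x x) = (norm x)\<^sup>2"
    by (simp add: cinner_self del: of_real_power)
qed

lemma linear_operator_scaleR_of_scaleC: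
  fixes E :: "'b::complex_inner set"
  assumes "linear_operator scaleC E B"
  shows "linear_operator scaleR E B"
proof -
  interpret C: vector_space "scaleC :: complex \<Rightarrow> 'b \<Rightarrow> 'b"
    by (rule vector_space_scaleC)
  have E: "C.subspace E"
    using assms by (simp add: linear_operator_def)
  have "subspace E"
    using C.subspace_0[OF E] C.subspace_add[OF E] C.subspace_scale[OF E]
    by (intro subspaceI) (auto simp: scaleC_of_real[symmetric])
  then show ?thesis
    using assms by (auto simp: linear_operator_def subspace_raw_def scaleC_of_real[symmetric])
qed

text \<open>Replacing x by \<open>scaleC \<i> x\<close>, which stays in the domain, turns the
  equality of real parts into that of imaginary parts.\<close>

lemma adjoint_graph_Re_cinner:
  fixes E :: "'b::complex_inner set"
  assumes lin: "linear_operator scaleC E B"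
  shows "adjoint_graph (\<lambda>x y. Re (cinner x y)) E B = adjoint_graph cinner E B"
proof -
  interpret C: vector_space "scaleC :: complex \<Rightarrow> 'b \<Rightarrow> 'b"
    by (rule vector_space_scaleC)
  have "cinner (B x) y = cinner x z"
    if re: "\<And>x. x \<in> E \<Longrightarrow> Re (cinner (B x) y) = Re (cinner x z)" and "x \<in> E" for x y z
  proof (rule complex_eqI)
    have "scaleC \<i> x \<in> E" "B (scaleC \<i> x) = scaleC \<i> (B x)"
      using lin \<open>x \<in> E\<close> C.subspace_scale by (auto simp: linear_operator_def)
    then show "Im (cinner (B x) y) = Im (cinner x z)"
      using re[of "scaleC \<i> x"] by (simp add: cinner_scaleC_left)
  qed (rule re[OF \<open>x \<in> E\<close>])
  then show ?thesis
    by (auto simp: adjoint_graph_def)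
qed

theorem lemma4:
  fixes D :: "'a::{real_inner, complete_space} set" and A :: "'a \<Rightarrow> 'a"
    and E :: "'b::complex_hilbert_space set" and B :: "'b \<Rightarrow> 'b"
  shows
    "(linear_operator (scaleR :: real \<Rightarrow> 'a \<Rightarrow> 'a) D A \<and>
      closed_operator D A \<and> hermitian_operator inner D A \<longrightarrow>
        (closure (\<Union>\<epsilon>\<in>{0<..}. bounded_vectors D A \<epsilon>) = UNIV \<longleftrightarrow>
         self_adjoint_operator inner D A)) \<and>
     (linear_operator (scaleC :: complex \<Rightarrow> 'b \<Rightarrow> 'b) E B \<and>
      closed_operator E B \<and> hermitian_operator cinner E B \<longrightarrow>
        (closure (\<Union>\<epsilon>\<in>{0<..}. bounded_vectors E B \<epsilon>) = UNIV \<longleftrightarrow>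
         self_adjoint_operator cinner E B))"
proof (intro conjI impI; elim conjE)
  assume "linear_operator (scaleR :: real \<Rightarrow> 'a \<Rightarrow> 'a) D A" "closed_operator D A"
    "hermitian_operator inner D A"
  then show "closure (\<Union>\<epsilon>\<in>{0<..}. bounded_vectors D A \<epsilon>) = UNIV \<longleftrightarrow>
      self_adjoint_operator inner D A"
    by (rule real_inner_form.dense_bounded_vectors_iff_self_adjoint[OF real_inner_form_inner])
next
  let ?re = "\<lambda>x y :: 'b. Re (cinner x y)"
  assume lin: "linear_operator (scaleC :: complex \<Rightarrow> 'b \<Rightarrow> 'b) E B" and cl: "closed_operator E B"
    and herm: "hermitian_operator cinner E B"
  have "hermitian_operator ?re E B"
    using herm by (simp add: hermitian_operator_def)
  then have "closure (\<Union>\<epsilon>\<in>{0<..}. bounded_vectors E B \<epsilon>) = UNIV \<longleftrightarrow> self_adjoint_operator ?re E B"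
    by (intro real_inner_form.dense_bounded_vectors_iff_self_adjoint[OF real_inner_form_Re_cinner]
        linear_operator_scaleR_of_scaleC lin cl)
  \<comment> \<open>Density and bounded vectors depend only on the norm and on powers of B; the form
    enters self-adjointness through the adjoint graph alone.\<close>
  also have "\<dots> \<longleftrightarrow> self_adjoint_operator cinner E B"
    by (simp add: self_adjoint_operator_def adjoint_graph_Re_cinner[OF lin])
  finally show "closure (\<Union>\<epsilon>\<in>{0<..}. bounded_vectors E B \<epsilon>) = UNIV \<longleftrightarrow>
      self_adjoint_operator cinner E B" .
qed

end
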